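(* Let $T$ be a finite tree with $V$ vertices. Then for all integers $k,n$ there is a natural isomorphism of $\mathbb{F}_2$-vector spaces $$SH^{k}(T,n)\cong SH^{V-2n+k}(T,V-n).$$
   Context: Let $T$ be a finite tree. A configuration $C$ on $T$ is a way of marking some vertices of $T$ by pluses and minuses and making some edges of $T$ red such that every vertex of $T$ is either marked by exactly one of the signs $+,-$ (and is then not an end of any red edge), or is unmarked and is the end of exactly one red edge. Let $Q(C)$ be the number of minuses of $C$, and let $E(C)$ be the sum of the number of minuses and the number of red edges. $SC(T)$ is the $\mathbb{F}_2$-vector space with basis the set of all configurations on $T$; $SC^{k}(T,n)$ is the subspace spanned by configurations with $Q(C)=k$, $E(C)=n$ (zero if there are none). Define a linear map $D:SC(T)\to SC(T)$ on basis elements: $D(C)$ is the sum, over all red edges $e$ of $C$, of the two configurations obtained from $C$ by making $e$ non-red and marking one of its ends by $+$ and the other by $-$ (in the two possible ways). Then $D^2=0$ and $D$ maps $SC^k(T,n)$ to $SC^{k+1}(T,n)$. The Seifert cohomology $SH^{k}(T,n)$ is the degree-$k$ cohomology of the complex $(SC^{\bullet}(T,n),D)$. *)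

theory Defs
  imports
    "HOL-Library.Z2"
    "HOL-Library.Poly_Mapping"
    "HOL-Algebra.Module"
    "HOL-Algebra.AbelCoset"
    "HOL-Algebra.Algebraic_Closure_Type"
begin

section \<open>Finite trees\<close>

record 'a ugraph =
  verts :: "'a set"
  edges :: "'a set set"

definition adjacency :: "'a ugraph \<Rightarrow> ('a \<times> 'a) set" where
  "adjacency T = {(u, v). {u, v} \<in> edges T}"

definition is_cycle :: "'a ugraph \<Rightarrow> 'a list \<Rightarrow> bool" where
  "is_cycle T p \<longleftrightarrow> 3 \<le> length p \<and> distinct p \<and>
     (\<forall>i<length p. {p ! i, p ! (Suc i mod length p)} \<in> edges T)"

definition finite_tree :: "'a ugraph \<Rightarrow> bool" where
  "finite_tree T \<longleftrightarrow>
     finite (verts T) \<and> verts T \<noteq> {} \<and>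
     (\<forall>e\<in>edges T. e \<subseteq> verts T \<and> card e = 2) \<and>
     (\<forall>u\<in>verts T. \<forall>v\<in>verts T. (u, v) \<in> (adjacency T)\<^sup>*) \<and>
     (\<nexists>p. is_cycle T p)"

definition tree_iso :: "('a \<Rightarrow> 'a) \<Rightarrow> 'a ugraph \<Rightarrow> 'a ugraph \<Rightarrow> bool" where
  "tree_iso f T T' \<longleftrightarrow> bij_betw f (verts T) (verts T') \<and>
     (\<forall>u\<in>verts T. \<forall>v\<in>verts T. {u, v} \<in> edges T \<longleftrightarrow> {f u, f v} \<in> edges T')"

section \<open>Configurations\<close>

record 'a config =
  pluses :: "'a set"
  minuses :: "'a set"
  red :: "'a set set"

definition configs :: "'a ugraph \<Rightarrow> 'a config set" where
  "configs T = {C. pluses C \<subseteq> verts T \<and> minuses C \<subseteq> verts T \<and> red C \<subseteq> edges T \<and>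
     (\<forall>v\<in>verts T.
        ((v \<in> pluses C) \<noteq> (v \<in> minuses C) \<and> (\<forall>e\<in>red C. v \<notin> e)) \<or>
        (v \<notin> pluses C \<and> v \<notin> minuses C \<and> (\<exists>!e. e \<in> red C \<and> v \<in> e)))}"

definition Q :: "'a config \<Rightarrow> nat" where
  "Q C = card (minuses C)"

definition E :: "'a config \<Rightarrow> nat" where
  "E C = card (minuses C) + card (red C)"

section \<open>Vector spaces over the field with two elements\<close>

abbreviation F2 :: "bit ring" where
  "F2 \<equiv> ring_of_type_algebra"

definition scale :: "bit \<Rightarrow> ('b \<Rightarrow>\<^sub>0 bit) \<Rightarrow> ('b \<Rightarrow>\<^sub>0 bit)" where
  "scale c x = Poly_Mapping.map ((*) c) x"

definition linear_extension :: "('b \<Rightarrow> ('c \<Rightarrow>\<^sub>0 bit)) \<Rightarrow> ('b \<Rightarrow>\<^sub>0 bit) \<Rightarrow> ('c \<Rightarrow>\<^sub>0 bit)" where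
  "linear_extension b x =
     (\<Sum>i\<in>Poly_Mapping.keys x. scale (Poly_Mapping.lookup x i) (b i))"

text \<open>
  Modules are records extending rings, so the fields \<open>mult\<close> and \<open>one\<close> are present
  but carry no meaning and are left unspecified.
\<close>

definition span_module :: "'b set \<Rightarrow> (bit, 'b \<Rightarrow>\<^sub>0 bit) module" where
  "span_module S =
     \<lparr>carrier = {x. Poly_Mapping.keys x \<subseteq> S}, monoid.mult = undefined, one = undefined,
      zero = 0, add = (+), module.smult = scale\<rparr>"

definition quotient_module :: "('r, 'm) module \<Rightarrow> 'm set \<Rightarrow> ('r, 'm set) module" where
  "quotient_module M N =
     \<lparr>carrier = a_rcosets\<^bsub>M\<^esub> N, monoid.mult = undefined, one = undefined,
      zero = N, add = set_add M, module.smult = (\<lambda>c A. \<Union>x\<in>A. N +>\<^bsub>M\<^esub> (c \<odot>\<^bsub>M\<^esub> x))\<rparr>"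

definition module_iso ::
  "('r, 'k) ring_scheme \<Rightarrow> ('r, 'm, 'p) module_scheme \<Rightarrow> ('r, 'n, 'q) module_scheme \<Rightarrow> ('m \<Rightarrow> 'n) set" where
  "module_iso R M N =
     {h. bij_betw h (carrier M) (carrier N) \<and>
         (\<forall>x\<in>carrier M. \<forall>y\<in>carrier M. h (x \<oplus>\<^bsub>M\<^esub> y) = h x \<oplus>\<^bsub>N\<^esub> h y) \<and>
         (\<forall>c\<in>carrier R. \<forall>x\<in>carrier M. h (c \<odot>\<^bsub>M\<^esub> x) = c \<odot>\<^bsub>N\<^esub> h x)}"

section \<open>Seifert cohomology\<close>

definition SC :: "'a ugraph \<Rightarrow> int \<Rightarrow> int \<Rightarrow> (bit, 'a config \<Rightarrow>\<^sub>0 bit) module" where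
  "SC T k n = span_module {C \<in> configs T. int (Q C) = k \<and> int (E C) = n}"

text \<open>Make the edge with ends \<open>u\<close> and \<open>v\<close> non-red, mark \<open>u\<close> by plus and \<open>v\<close> by minus.\<close>

definition resolve :: "'a config \<Rightarrow> 'a \<times> 'a \<Rightarrow> 'a config" where
  "resolve C = (\<lambda>(u, v). \<lparr>pluses = insert u (pluses C), minuses = insert v (minuses C),
                          red = red C - {{u, v}}\<rparr>)"

text \<open>The set \<open>{(u, v). {u, v} = e}\<close> consists of the two orderings of the ends of \<open>e\<close>.\<close>

definition D :: "('a config \<Rightarrow>\<^sub>0 bit) \<Rightarrow> ('a config \<Rightarrow>\<^sub>0 bit)" where
  "D = linear_extension
     (\<lambda>C. \<Sum>e\<in>red C. \<Sum>p\<in>{(u, v). {u, v} = e}. Poly_Mapping.single (resolve C p) 1)"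

definition cocycles :: "'a ugraph \<Rightarrow> int \<Rightarrow> int \<Rightarrow> ('a config \<Rightarrow>\<^sub>0 bit) set" where
  "cocycles T k n = {x \<in> carrier (SC T k n). D x = 0}"

definition coboundaries :: "'a ugraph \<Rightarrow> int \<Rightarrow> int \<Rightarrow> ('a config \<Rightarrow>\<^sub>0 bit) set" where
  "coboundaries T k n = D ` carrier (SC T (k - 1) n)"

definition SH :: "'a ugraph \<Rightarrow> int \<Rightarrow> int \<Rightarrow> (bit, ('a config \<Rightarrow>\<^sub>0 bit) set) module" where
  "SH T k n = quotient_module ((SC T k n)\<lparr>carrier := cocycles T k n\<rparr>) (coboundaries T k n)"

section \<open>Functoriality\<close>

definition map_config :: "('a \<Rightarrow> 'a) \<Rightarrow> 'a config \<Rightarrow> 'a config" where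
  "map_config f C =
     \<lparr>pluses = f ` pluses C, minuses = f ` minuses C, red = (\<lambda>e. f ` e) ` red C\<rparr>"

definition SC_map :: "('a \<Rightarrow> 'a) \<Rightarrow> ('a config \<Rightarrow>\<^sub>0 bit) \<Rightarrow> ('a config \<Rightarrow>\<^sub>0 bit)" where
  "SC_map f = linear_extension (\<lambda>C. Poly_Mapping.single (map_config f C) 1)"

text \<open>
  Cohomology classes are cosets of the coboundaries.  For an isomorphism \<open>f\<close> of trees the
  cochain map \<open>SC_map f\<close> is bijective, so the image of the class of \<open>z\<close> is exactly the class
  of \<open>SC_map f z\<close>.
\<close>

definition SH_map :: "('a \<Rightarrow> 'a) \<Rightarrow> ('a config \<Rightarrow>\<^sub>0 bit) set \<Rightarrow> ('a config \<Rightarrow>\<^sub>0 bit) set" where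
  "SH_map f A = SC_map f ` A"

section \<open>The cohomology groups are vector spaces over the field with two elements\<close>

lemma lookup_scale [simp]: "Poly_Mapping.lookup (scale c x) i = c * Poly_Mapping.lookup x i"
  by (simp add: scale_def Poly_Mapping.map.rep_eq when_def)

lemma scale_simps [simp]: "scale 0 x = 0" "scale 1 x = x" "scale c 0 = 0"
  by (auto intro!: poly_mapping_eqI)

lemma scale_add: "scale c (x + y) = scale c x + scale c y" "scale (a + b) x = scale a x + scale b x"
  "scale (a * b) x = scale a (scale b x)"
  by (rule poly_mapping_eqI; simp only: lookup_add lookup_scale distrib_left distrib_right mult.assoc)+

lemma chain_add_self: "x + x = (0 :: 'b \<Rightarrow>\<^sub>0 bit)"
  by (auto intro!: poly_mapping_eqI simp: lookup_add)

lemma linear_extension_superset: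
  assumes "finite A" "Poly_Mapping.keys x \<subseteq> A"
  shows "linear_extension b x = (\<Sum>i\<in>A. scale (Poly_Mapping.lookup x i) (b i))"
  unfolding linear_extension_def
  using assms by (intro sum.mono_neutral_left) (auto simp: in_keys_iff)

lemma linear_extension_add:
  "linear_extension b (x + y) = linear_extension b x + linear_extension b y"
proof -
  let ?A = "Poly_Mapping.keys x \<union> Poly_Mapping.keys y"
  have "Poly_Mapping.keys (x + y) \<subseteq> ?A" by (rule Poly_Mapping.keys_add)
  then show ?thesis
    by (simp only: linear_extension_superset[of ?A] lookup_add scale_add sum.distrib finite_UnI finite_keys Un_upper1 Un_upper2)
qed

lemma linear_extension_0 [simp]: "linear_extension b 0 = 0"
  by (simp add: linear_extension_def)

lemma linear_extension_single [simp]: "linear_extension b (Poly_Mapping.single i 1) = b i"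
  by (simp add: linear_extension_def)

lemma linear_extension_scale: "linear_extension b (scale c x) = scale c (linear_extension b x)"
  by (cases c) simp_all

lemma linear_extension_sum:
  "linear_extension b (\<Sum>i\<in>I. g i) = (\<Sum>i\<in>I. linear_extension b (g i))"
  by (induction I rule: infinite_finite_induct) (simp_all add: linear_extension_add)

lemma sum_off_diagonal_symmetric:
  fixes g :: "'e \<Rightarrow> 'e \<Rightarrow> ('b \<Rightarrow>\<^sub>0 bit)"
  assumes "finite R" and sym: "\<And>e e'. g e e' = g e' e"
  shows "(\<Sum>e\<in>R. \<Sum>e'\<in>R - {e}. g e e') = 0"
  using assms(1)
proof (induction R)
  case (insert a R)
  have "(\<Sum>e\<in>R. \<Sum>e'\<in>insert a R - {e}. g e e') = (\<Sum>e\<in>R. g e a + (\<Sum>e'\<in>R - {e}. g e e'))"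
  proof (rule sum.cong)
    fix e assume "e \<in> R"
    with insert have "insert a R - {e} = insert a (R - {e})" "a \<notin> R - {e}" by auto
    with insert show "(\<Sum>e'\<in>insert a R - {e}. g e e') = g e a + (\<Sum>e'\<in>R - {e}. g e e')"
      by simp
  qed simp
  also have "\<dots> = (\<Sum>e\<in>R. g e a)"
    using insert by (simp add: sum.distrib)
  also have "\<dots> = (\<Sum>e\<in>R. g a e)" by (simp add: sym[of _ a])
  finally show ?case using insert by (simp add: chain_add_self)
qed simp

lemma D_D: "D (D x) = (0 :: 'a config \<Rightarrow>\<^sub>0 bit)"
proof -
  define d where "d = (\<lambda>C :: 'a config. \<Sum>e\<in>red C. \<Sum>p\<in>{(u, v). {u, v} = e}. Poly_Mapping.single (resolve C p) (1 :: bit))"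
  have D: "D = linear_extension d" by (simp add: D_def d_def)
  have dd: "D (d C) = 0" for C :: "'a config"
  proof (cases "finite (red C)")
    case True
    define g where "g e e' = (\<Sum>p\<in>{(u, v). {u, v} = e}. \<Sum>q\<in>{(u, v). {u, v} = e'}.
        Poly_Mapping.single (resolve (resolve C p) q) (1::bit))" for e e'
    have "D (d C) = (\<Sum>e\<in>red C. \<Sum>p\<in>{(u, v). {u, v} = e}. d (resolve C p))"
      unfolding D by (subst (2) d_def) (simp add: linear_extension_sum)
    also have "\<dots> = (\<Sum>e\<in>red C. \<Sum>p\<in>{(u, v). {u, v} = e}. \<Sum>e'\<in>red C - {e}.
         \<Sum>q\<in>{(u, v). {u, v} = e'}. Poly_Mapping.single (resolve (resolve C p) q) 1)"
      by (intro sum.cong) (auto simp: d_def resolve_def)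
    also have "\<dots> = (\<Sum>e\<in>red C. \<Sum>e'\<in>red C - {e}. g e e')"
      unfolding g_def by (intro sum.cong refl, subst sum.swap) simp
    also have "\<dots> = 0"
    proof (rule sum_off_diagonal_symmetric[OF True])
      fix e e'
      have "resolve (resolve C p) q = resolve (resolve C q) p" for p q
        by (auto simp: resolve_def split: prod.splits)
      then show "g e e' = g e' e" unfolding g_def by (subst sum.swap) simp
    qed
    finally show ?thesis .
  qed (simp add: D d_def)
  have "D (D x) = (\<Sum>i\<in>Poly_Mapping.keys x. scale (Poly_Mapping.lookup x i) (D (d i)))"
    by (subst (2) D, subst linear_extension_def) (simp add: D linear_extension_sum linear_extension_scale)
  then show ?thesis by (simp add: dd)
qed

lemma resolve_configs:
  assumes T: "finite_tree T" and C: "C \<in> configs T" and e: "{u, v} \<in> red C"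
  shows "resolve C (u, v) \<in> configs T" "Q (resolve C (u, v)) = Suc (Q C)"
    "E (resolve C (u, v)) = E C"
proof -
  have ed: "{u, v} \<in> edges T" using C e by (auto simp: configs_def)
  then have c2: "card {u, v} = 2" and uv: "u \<in> verts T" "v \<in> verts T"
    using T by (auto simp: finite_tree_def)
  then have ne: "u \<noteq> v" by auto
  have conf: "((w \<in> pluses C) \<noteq> (w \<in> minuses C) \<and> (\<forall>e\<in>red C. w \<notin> e)) \<or>
        (w \<notin> pluses C \<and> w \<notin> minuses C \<and> (\<exists>!e. e \<in> red C \<and> w \<in> e))" if "w \<in> verts T" for w
    using C that by (auto simp: configs_def)
  have u: "u \<notin> pluses C" "u \<notin> minuses C" "\<And>e. e \<in> red C \<Longrightarrow> u \<in> e \<Longrightarrow> e = {u, v}"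
    using conf[OF uv(1)] e by blast+
  have v: "v \<notin> pluses C" "v \<notin> minuses C" "\<And>e. e \<in> red C \<Longrightarrow> v \<in> e \<Longrightarrow> e = {u, v}"
    using conf[OF uv(2)] e by blast+
  have fin: "finite (minuses C)" "finite (red C)"
  proof -
    show "finite (minuses C)" using C T by (auto simp: configs_def finite_tree_def intro: finite_subset)
    have "red C \<subseteq> Pow (verts T)" using C T by (auto simp: configs_def finite_tree_def)
    then show "finite (red C)" using T by (auto simp: finite_tree_def intro: finite_subset)
  qed
  show "Q (resolve C (u, v)) = Suc (Q C)" using v fin by (simp add: Q_def resolve_def)
  show "E (resolve C (u, v)) = E C"
    using v fin card.remove[OF fin(2) e] by (simp add: E_def resolve_def)
  have P: "pluses (resolve C (u, v)) = insert u (pluses C)" "minuses (resolve C (u, v)) = insert v (minuses C)"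
     "red (resolve C (u, v)) = red C - {{u, v}}" by (simp_all add: resolve_def)
  show "resolve C (u, v) \<in> configs T"
    unfolding configs_def P mem_Collect_eq
  proof (intro conjI ballI)
    fix w assume w: "w \<in> verts T"
    show "((w \<in> insert u (pluses C)) \<noteq> (w \<in> insert v (minuses C)) \<and> (\<forall>e\<in>red C - {{u, v}}. w \<notin> e)) \<or>
         (w \<notin> insert u (pluses C) \<and> w \<notin> insert v (minuses C) \<and> (\<exists>!e. e \<in> red C - {{u, v}} \<and> w \<in> e))"
    proof (cases "w = u \<or> w = v")
      case True
      then show ?thesis using u v ne by blast
    next
      case False
      then have "e \<in> red C - {{u, v}} \<and> w \<in> e \<longleftrightarrow> e \<in> red C \<and> w \<in> e" for e by blast
      with conf[OF w] False show ?thesis by blast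
    qed
  qed (use C uv in \<open>auto simp: configs_def\<close>)
qed

lemma keys_scale: "Poly_Mapping.keys (scale c x) \<subseteq> Poly_Mapping.keys x"
  by (auto simp: in_keys_iff)

lemma keys_sum_subset:
  assumes "\<And>i. i \<in> I \<Longrightarrow> Poly_Mapping.keys (h i :: 'b \<Rightarrow>\<^sub>0 bit) \<subseteq> S"
  shows "Poly_Mapping.keys (\<Sum>i\<in>I. h i) \<subseteq> S"
  using assms Poly_Mapping.keys_sum[of h I] by blast

lemma D_closed:
  assumes T: "finite_tree T" and x: "x \<in> carrier (SC T k n)"
  shows "D x \<in> carrier (SC T (k + 1) n)"
proof -
  let ?S = "{C \<in> configs T. int (Q C) = k + 1 \<and> int (E C) = n}"
  have "Poly_Mapping.keys (D x) \<subseteq> ?S"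
    unfolding D_def linear_extension_def
  proof (intro keys_sum_subset order.trans[OF keys_scale])
    fix C e p assume C: "C \<in> Poly_Mapping.keys x" and e: "e \<in> red C" and p: "p \<in> {(u, v). {u, v} = e}"
    from p obtain u v where "p = (u, v)" "e = {u, v}" by auto
    moreover have "C \<in> configs T" "int (Q C) = k" "int (E C) = n"
      using x C by (auto simp: SC_def span_module_def)
    ultimately show "Poly_Mapping.keys (Poly_Mapping.single (resolve C p) (1::bit)) \<subseteq> ?S"
      using resolve_configs[OF T, of C u v] e by auto
  qed
  then show ?thesis by (simp add: SC_def span_module_def)
qed


text \<open>Over the field with two elements closure under scaling is automatic.\<close>

definition is_subspace :: "('b \<Rightarrow>\<^sub>0 bit) set \<Rightarrow> bool" where
  "is_subspace S \<longleftrightarrow> 0 \<in> S \<and> (\<forall>x\<in>S. \<forall>y\<in>S. x + y \<in> S)"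

lemma module_quotient:
  fixes M :: "(bit, 'b \<Rightarrow>\<^sub>0 bit) module"
  assumes Z: "is_subspace (carrier M)" and N: "is_subspace N" "N \<subseteq> carrier M"
    and ops: "add M = (+)" "zero M = 0" "module.smult M = scale"
  shows "module F2 (quotient_module M N)"
proof -
  define cs where "cs z = (\<lambda>n. n + z) ` N" for z
  have coset: "N +>\<^bsub>M\<^esub> z = cs z" for z
    by (auto simp: a_r_coset_def' ops cs_def)
  have add: "set_add M A B = {a + b | a b. a \<in> A \<and> b \<in> B}" for A B
    by (auto simp: set_add_def set_mult_def ops)
  have mem: "y \<in> cs z \<longleftrightarrow> y + z \<in> N" for y z
  proof -
    have "y = (y + z) + z" "n + z + z = n" for n by (simp_all add: add.assoc chain_add_self)
    then show ?thesis unfolding cs_def by (metis (no_types, lifting) image_iff)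
  qed
  have Np: "x + y \<in> N" if "x \<in> N" "y \<in> N" for x y using N that by (auto simp: is_subspace_def)
  have cs_add: "set_add M (cs a) (cs b) = cs (a + b)" for a b
  proof (rule Set.set_eqI)
    fix y
    show "y \<in> set_add M (cs a) (cs b) \<longleftrightarrow> y \<in> cs (a + b)"
    proof
      assume "y \<in> set_add M (cs a) (cs b)"
      then obtain p q where "y = p + q" "p + a \<in> N" "q + b \<in> N" by (auto simp: add mem)
      then show "y \<in> cs (a + b)" using Np[of "p + a" "q + b"] by (simp add: mem add_ac)
    next
      assume "y \<in> cs (a + b)"
      then have "y + b \<in> cs a" by (simp add: mem add_ac)
      moreover have "b \<in> cs b" using N by (simp add: mem chain_add_self is_subspace_def)
      moreover have "y = (y + b) + b" by (simp add: add.assoc chain_add_self)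
      ultimately show "y \<in> set_add M (cs a) (cs b)" unfolding add by blast
    qed
  qed
  have cs_shift: "cs (n + z) = cs z" if "n \<in> N" for n z
  proof (rule Set.set_eqI)
    fix y
    have "y + z = (y + (n + z)) + n" by (metis add.assoc add.commute add.right_neutral chain_add_self)
    moreover have "y + (n + z) = (y + z) + n" by (simp add: add_ac)
    ultimately show "y \<in> cs (n + z) \<longleftrightarrow> y \<in> cs z" unfolding mem using Np that by metis
  qed
  have sc0: "scale c n \<in> N" if "n \<in> N" for c n using that N by (cases c) (auto simp: is_subspace_def)
  have sc1: "scale c n \<in> carrier M" if "n \<in> carrier M" for c n using that Z by (cases c) (auto simp: is_subspace_def)
  have cs_sc: "(\<Union>x\<in>cs z. N +>\<^bsub>M\<^esub> (c \<odot>\<^bsub>M\<^esub> x)) = cs (scale c z)" for c z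
  proof -
    have "cs (scale c x) = cs (scale c z)" if "x \<in> cs z" for x
      using that unfolding cs_def[of z] by (auto simp only: scale_add cs_shift sc0 image_iff)
    moreover have "cs z \<noteq> {}" using N by (auto simp: cs_def is_subspace_def)
    ultimately show ?thesis by (simp add: coset ops)
  qed
  have N0: "N = cs 0" by (simp add: cs_def)
  have car: "carrier (quotient_module M N) = cs ` carrier M"
    by (auto simp: quotient_module_def A_RCOSETS_def' coset)
  have qs: "add (quotient_module M N) = set_add M" "zero (quotient_module M N) = cs 0"
    "module.smult (quotient_module M N) c (cs z) = cs (scale c z)" for c z
    using N0 cs_sc by (simp_all add: quotient_module_def)
  show ?thesis
  proof (rule moduleI)
    show "cring F2" by (rule cring_from_type_algebra)
    show "abelian_group (quotient_module M N)"
    proof (rule abelian_groupI)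
      fix x assume "x \<in> carrier (quotient_module M N)"
      then obtain z where z: "z \<in> carrier M" "x = cs z" by (auto simp: car)
      show "\<exists>y\<in>carrier (quotient_module M N). y \<oplus>\<^bsub>quotient_module M N\<^esub> x = \<zero>\<^bsub>quotient_module M N\<^esub>"
        using z by (intro bexI[of _ x]) (auto simp: qs cs_add car chain_add_self)
    qed (use Z in \<open>auto simp: car qs cs_add is_subspace_def add_ac\<close>)
  qed (simp_all only: car qs(1,2), auto simp only: qs cs_add ring_of_type_algebra_def scale_add ring.simps monoid.simps partial_object.simps scale_simps intro: imageI sc1)
qed

lemma D_add: "D (x + y) = D x + D y"
  by (simp add: D_def linear_extension_add)

lemma D_0: "D 0 = 0"
  by (simp add: D_def)

lemma is_subspace_SC: "is_subspace (carrier (SC T k n))"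
  using Poly_Mapping.keys_add by (fastforce simp: is_subspace_def SC_def span_module_def)

lemma module_SH:
  assumes "finite_tree T"
  shows "module F2 (SH T k n)"
  unfolding SH_def
proof (rule module_quotient)
  show "is_subspace (carrier (SC T k n\<lparr>carrier := cocycles T k n\<rparr>))"
    using is_subspace_SC[of T k n] by (auto simp: is_subspace_def cocycles_def D_add D_0)
  show "is_subspace (coboundaries T k n)"
    using is_subspace_SC[of T "k-1" n] unfolding is_subspace_def coboundaries_def
    by (auto simp flip: D_add) (metis D_0 imageI)
  show "coboundaries T k n \<subseteq> carrier (SC T k n\<lparr>carrier := cocycles T k n\<rparr>)"
    using D_closed[OF assms, of _ "k-1" n] by (auto simp: coboundaries_def cocycles_def D_D)
qed (simp_all add: SC_def span_module_def)

end

theory Submission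
  imports Defs
begin

text \<open>
  Exchanging plus and minus is an involution of the set of configurations. It commutes with \<open>D\<close>,
  which sums over both ways of marking the ends of a red edge. If \<open>p\<close>, \<open>q\<close>, \<open>r\<close> are the numbers
  of pluses, minuses and red edges, then \<open>p + q + 2 r = V\<close>; so from \<open>q = k\<close> and \<open>q + r = n\<close> it
  follows that \<open>p = V - 2 n + k\<close> and \<open>p + r = V - n\<close>.
\<close>

definition swap_signs :: "'a config \<Rightarrow> 'a config" where
  "swap_signs C = \<lparr>pluses = minuses C, minuses = pluses C, red = red C\<rparr>"

definition SC_swap :: "('a config \<Rightarrow>\<^sub>0 bit) \<Rightarrow> ('a config \<Rightarrow>\<^sub>0 bit)" where
  "SC_swap = linear_extension (\<lambda>C. Poly_Mapping.single (swap_signs C) 1)"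

lemma swap_signs_sel [simp]:
  "pluses (swap_signs C) = minuses C" "minuses (swap_signs C) = pluses C"
  "red (swap_signs C) = red C"
  by (simp_all add: swap_signs_def)

lemma swap_signs_swap_signs [simp]: "swap_signs (swap_signs C) = C"
  by (simp add: swap_signs_def)

text \<open>Reduces identities between composites of linear extensions to identities on single
  configurations; the involution property and both commutation rules below are obtained this
  way.\<close>

lemma linear_extension_compose:
  "linear_extension b (linear_extension c x) = linear_extension (\<lambda>i. linear_extension b (c i)) x"
  by (simp add: linear_extension_def[of c] linear_extension_def[of "\<lambda>i. linear_extension b (c i)"]
      linear_extension_sum linear_extension_scale)

lemma linear_extension_single_id: "linear_extension (\<lambda>i. Poly_Mapping.single i 1) x = x"
proof (rule poly_mapping_eqI)
  fix j
  have "Poly_Mapping.lookup (linear_extension (\<lambda>i. Poly_Mapping.single i 1) x) j =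
      (\<Sum>i\<in>Poly_Mapping.keys x. if i = j then Poly_Mapping.lookup x i else 0)"
    unfolding linear_extension_def lookup_sum
    by (intro sum.cong) (auto simp: lookup_single when_def)
  also have "\<dots> = Poly_Mapping.lookup x j"
    \<comment> \<open>If \<open>j\<close> is not a key, the sum is empty of nonzero terms and the
      coefficient at \<open>j\<close> is 0 as well.\<close>
    by (simp add: sum.delta' in_keys_iff)
  finally show "Poly_Mapping.lookup (linear_extension (\<lambda>i. Poly_Mapping.single i 1) x) j =
      Poly_Mapping.lookup x j" .
qed

lemma SC_swap_SC_swap [simp]: "SC_swap (SC_swap x) = x"
  by (simp add: SC_swap_def linear_extension_compose linear_extension_single_id)

lemma SC_swap_add: "SC_swap (x + y) = SC_swap x + SC_swap y"
  by (simp add: SC_swap_def linear_extension_add)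

lemma SC_swap_scale: "SC_swap (scale c x) = scale c (SC_swap x)"
  by (simp add: SC_swap_def linear_extension_scale)

lemma SC_swap_0 [simp]: "SC_swap 0 = 0"
  by (simp add: SC_swap_def)

lemma SC_swap_SC_map: "SC_swap (SC_map f x) = SC_map f (SC_swap x)"
  by (simp add: SC_swap_def SC_map_def linear_extension_compose map_config_def swap_signs_def)

text \<open>Marking \<open>u\<close> by plus and \<open>v\<close> by minus and then exchanging signs
  amounts to using the opposite ordering of the ends; the red edge removed is the same unordered
  pair.\<close>

lemma swap_signs_resolve: "swap_signs (resolve C p) = resolve (swap_signs C) (prod.swap p)"
  by (cases p) (simp add: resolve_def swap_signs_def insert_commute)

lemma D_SC_swap: "D (SC_swap x) = SC_swap (D x)"
proof -
  \<comment> \<open>Reversing pairs permutes the orderings of the ends of \<open>e\<close>, so the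
    reversal produced by \<open>swap_signs_resolve\<close> disappears in the sum.\<close>
  have "(\<Sum>p\<in>{(u, v). {u, v} = e}. Poly_Mapping.single (resolve (swap_signs C) p) (1 :: bit)) =
      (\<Sum>p\<in>{(u, v). {u, v} = e}. Poly_Mapping.single (resolve (swap_signs C) (prod.swap p)) 1)"
    for e and C :: "'a config"
    by (rule sum.reindex_bij_witness[of _ prod.swap prod.swap]) auto
  then show ?thesis
    by (simp add: D_def SC_swap_def linear_extension_compose linear_extension_sum swap_signs_resolve)
qed

lemma finite_config:
  assumes "finite_tree T" "C \<in> configs T"
  shows "finite (pluses C)" "finite (minuses C)" "finite (red C)"
proof -
  have "finite (verts T)" "pluses C \<subseteq> verts T" "minuses C \<subseteq> verts T" "red C \<subseteq> Pow (verts T)"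
    using assms by (auto simp: configs_def finite_tree_def)
  then show "finite (pluses C)" "finite (minuses C)" "finite (red C)"
    by (meson finite_subset finite_Pow_iff)+
qed

text \<open>The vertices split into pluses, minuses and ends of red edges. Red edges are pairwise
  disjoint, as a vertex lies on at most one of them, and each has two ends.\<close>

lemma card_verts_config:
  assumes T: "finite_tree T" and C: "C \<in> configs T"
  shows "card (verts T) = card (pluses C) + card (minuses C) + 2 * card (red C)"
proof -
  have v: "v \<in> verts T \<Longrightarrow> ((v \<in> pluses C) \<noteq> (v \<in> minuses C) \<and> (\<forall>e\<in>red C. v \<notin> e)) \<or>
        (v \<notin> pluses C \<and> v \<notin> minuses C \<and> (\<exists>!e. e \<in> red C \<and> v \<in> e))" for v
    using C by (simp add: configs_def)
  have e: "e \<subseteq> verts T" "card e = 2" if "e \<in> red C" for e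
    using T C that by (auto simp: configs_def finite_tree_def)
  have sub: "pluses C \<subseteq> verts T" "minuses C \<subseteq> verts T"
    using C by (auto simp: configs_def)
  \<comment> \<open>An infinite set has \<open>card\<close> 0, which is not 2.\<close>
  have fin: "finite e" if "e \<in> red C" for e
    using e[OF that] by (metis card.infinite zero_neq_numeral)
  have U: "verts T = pluses C \<union> minuses C \<union> \<Union>(red C)"
    using v e(1) sub by blast
  have disj: "pluses C \<inter> minuses C = {}" "(pluses C \<union> minuses C) \<inter> \<Union>(red C) = {}"
    using v sub by blast+
  have "pairwise disjnt (red C)"
    unfolding pairwise_def disjnt_def using v e(1) by blast
  then have "card (\<Union>(red C)) = sum card (red C)"
    using fin by (intro card_Union_disjoint)
  also have "\<dots> = 2 * card (red C)" using e(2) by simp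
  finally show ?thesis
    using finite_config[OF T C] fin disj by (simp add: U card_Un_disjoint)
qed

lemma swap_signs_configs:
  assumes "finite_tree T" "C \<in> configs T"
  shows "swap_signs C \<in> configs T"
    "int (Q (swap_signs C)) = int (card (verts T)) - 2 * int (E C) + int (Q C)"
    "int (E (swap_signs C)) = int (card (verts T)) - int (E C)"
proof -
  show "swap_signs C \<in> configs T"
    using assms(2) unfolding configs_def by (simp add: conj_commute) metis
qed (use card_verts_config[OF assms] in \<open>simp_all add: Q_def E_def\<close>)

lemma SC_swap_closed:
  assumes T: "finite_tree T" and x: "x \<in> carrier (SC T k n)"
  shows "SC_swap x \<in> carrier (SC T (int (card (verts T)) - 2 * n + k) (int (card (verts T)) - n))"
proof -
  have "Poly_Mapping.keys (SC_swap x) \<subseteq> {C \<in> configs T.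
      int (Q C) = int (card (verts T)) - 2 * n + k \<and> int (E C) = int (card (verts T)) - n}"
    unfolding SC_swap_def linear_extension_def
  proof (intro keys_sum_subset order.trans[OF keys_scale])
    fix C assume "C \<in> Poly_Mapping.keys x"
    then have "C \<in> configs T" "int (Q C) = k" "int (E C) = n"
      using x by (auto simp: SC_def span_module_def)
    then show "Poly_Mapping.keys (Poly_Mapping.single (swap_signs C) (1::bit)) \<subseteq> {C \<in> configs T.
      int (Q C) = int (card (verts T)) - 2 * n + k \<and> int (E C) = int (card (verts T)) - n}"
      using swap_signs_configs[OF T, of C] by auto
  qed
  then show ?thesis by (simp add: SC_def span_module_def)
qed

text \<open>Surjectivity comes from \<open>y = g (g y)\<close>. Thus closure in both directions is
  enough for an equality of images.\<close>

lemma image_involution_eq: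
  assumes "\<And>x. x \<in> A \<Longrightarrow> g x \<in> B" "\<And>y. y \<in> B \<Longrightarrow> g y \<in> A" "\<And>y. g (g y) = y"
  shows "g ` A = B"
  using assms by (metis image_eqI image_subsetI subsetI subset_antisym)

text \<open>The change of indices is an involution too: with \<open>V\<close> vertices,
  \<open>V - 2 * (V - n) + (V - 2 * n + k) = k\<close> and \<open>V - (V - n) = n\<close>. Hence
  \<open>SC_swap_closed\<close> at \<open>k'\<close>, \<open>n'\<close> leads back to
  \<open>k\<close>, \<open>n\<close>.\<close>

lemma SC_swap_carrier:
  assumes T: "finite_tree T"
    and k': "k' = int (card (verts T)) - 2 * n + k" and n': "n' = int (card (verts T)) - n"
  shows "SC_swap ` carrier (SC T k n) = carrier (SC T k' n')"
  using SC_swap_closed[OF T, of _ k n] SC_swap_closed[OF T, of _ k' n']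
  by (intro image_involution_eq) (simp_all add: k' n')

lemma SC_swap_cocycles:
  assumes T: "finite_tree T"
    and k': "k' = int (card (verts T)) - 2 * n + k" and n': "n' = int (card (verts T)) - n"
  shows "SC_swap ` cocycles T k n = cocycles T k' n'"
  using SC_swap_closed[OF T, of _ k n] SC_swap_closed[OF T, of _ k' n']
  by (intro image_involution_eq) (auto simp: cocycles_def D_SC_swap k' n')

lemma SC_swap_coboundaries:
  assumes "finite_tree T"
    and "k' = int (card (verts T)) - 2 * n + k" and "n' = int (card (verts T)) - n"
  shows "SC_swap ` coboundaries T k n = coboundaries T k' n'"
proof -
  \<comment> \<open>For fixed \<open>n\<close> the change of degree is a translation, so
    \<open>k - 1\<close> corresponds to \<open>k' - 1\<close>.\<close>
  have "SC_swap ` carrier (SC T (k - 1) n) = carrier (SC T (k' - 1) n')"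
    by (rule SC_swap_carrier) (use assms in simp_all)
  then show ?thesis
    unfolding coboundaries_def by (metis (mono_tags, lifting) D_SC_swap image_cong image_image)
qed

text \<open>Classes are cosets, so the induced map on them is the direct image under
  \<open>g\<close>. It carries cosets of \<open>N\<close> to cosets of \<open>N'\<close>, and it is
  injective on all sets because \<open>g\<close> is injective.\<close>

lemma quotient_module_iso_image:
  fixes M M' :: "(bit, 'b \<Rightarrow>\<^sub>0 bit) module"
  assumes ops: "add M = (+)" "module.smult M = scale" "add M' = (+)" "module.smult M' = scale"
    and g: "inj g" "\<And>x y. g (x + y) = g x + g y" "\<And>c x. g (scale c x) = scale c (g x)"
    and M': "g ` carrier M = carrier M'" and N': "g ` N = N'"
  shows "(`) g \<in> module_iso F2 (quotient_module M N) (quotient_module M' N')"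
proof -
  have coset: "g ` (N +>\<^bsub>M\<^esub> z) = N' +>\<^bsub>M'\<^esub> g z" for z
    unfolding a_r_coset_def' N'[symmetric] by (simp add: ops g(2) image_UN)
  have "(`) g ` carrier (quotient_module M N) = (\<lambda>z. g ` (N +>\<^bsub>M\<^esub> z)) ` carrier M"
    by (auto simp: quotient_module_def A_RCOSETS_def')
  also have "\<dots> = (\<lambda>z. N' +>\<^bsub>M'\<^esub> z) ` carrier M'"
    unfolding coset M'[symmetric] image_image ..
  also have "\<dots> = carrier (quotient_module M' N')"
    by (auto simp: quotient_module_def A_RCOSETS_def')
  finally have carrier: "(`) g ` carrier (quotient_module M N) = carrier (quotient_module M' N')" .
  have "inj_on ((`) g) (carrier (quotient_module M N))"
    using g(1) by (simp add: inj_on_def inj_image_eq_iff)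
  moreover have "g ` set_add M A B = set_add M' (g ` A) (g ` B)" for A B
  proof -
    \<comment> \<open>Written as unions of images, both sums can be compared by moving
      \<open>g\<close> inside the unions.\<close>
    have "set_add M A B = (\<Union>a\<in>A. (\<lambda>b. a + b) ` B)"
      "set_add M' (g ` A) (g ` B) = (\<Union>a\<in>A. (\<lambda>b. g a + g b) ` B)"
      by (auto simp: set_add_def set_mult_def ops)
    then show ?thesis by (simp add: image_UN image_image g(2))
  qed
  moreover have "g ` (\<Union>x\<in>A. N +>\<^bsub>M\<^esub> (c \<odot>\<^bsub>M\<^esub> x)) = (\<Union>x\<in>g ` A. N' +>\<^bsub>M'\<^esub> (c \<odot>\<^bsub>M'\<^esub> x))" for c A
    unfolding image_UN coset ops g(3) by simp
  ultimately show ?thesis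
    using carrier by (simp add: module_iso_def bij_betw_def) (simp add: quotient_module_def)
qed

theorem lemma2:
  shows "\<exists>\<Phi> :: 'a ugraph \<Rightarrow> int \<Rightarrow> int \<Rightarrow> ('a config \<Rightarrow>\<^sub>0 bit) set \<Rightarrow> ('a config \<Rightarrow>\<^sub>0 bit) set.
    (\<forall>T. finite_tree T \<longrightarrow>
      (\<forall>k n. \<Phi> T k n \<in> module_iso F2 (SH T k n)
         (SH T (int (card (verts T)) - 2 * n + k) (int (card (verts T)) - n)))) \<and>
    (\<forall>T T' f. finite_tree T \<and> finite_tree T' \<and> tree_iso f T T' \<longrightarrow>
      (\<forall>k n. \<forall>\<xi>\<in>carrier (SH T k n).
         \<Phi> T' k n (SH_map f \<xi>) = SH_map f (\<Phi> T k n \<xi>)))"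
proof (intro exI conjI allI impI ballI)
  fix T :: "'a ugraph" and k n :: int
  assume T: "finite_tree T"
  have "inj (SC_swap :: ('a config \<Rightarrow>\<^sub>0 bit) \<Rightarrow> _)"
    by (rule inj_on_inverseI[of _ SC_swap]) simp
  \<comment> \<open>This instantiates the witness: for all \<open>T\<close>, \<open>k\<close>,
    \<open>n\<close> it is the direct image under \<open>SC_swap\<close>.\<close>
  then show "(`) SC_swap \<in> module_iso F2 (SH T k n)
      (SH T (int (card (verts T)) - 2 * n + k) (int (card (verts T)) - n))"
    unfolding SH_def
    by (intro quotient_module_iso_image)
      (simp_all add: SC_def span_module_def SC_swap_add SC_swap_scale
        SC_swap_cocycles[OF T refl refl] SC_swap_coboundaries[OF T refl refl])
next
  fix f :: "'a \<Rightarrow> 'a" and \<xi> :: "('a config \<Rightarrow>\<^sub>0 bit) set"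
  \<comment> \<open>Naturality already holds for cochains: relabelling vertices commutes with
    exchanging signs.\<close>
  show "SC_swap ` SH_map f \<xi> = SH_map f (SC_swap ` \<xi>)"
    by (simp add: SH_map_def image_image SC_swap_SC_map)
qed

end
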